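(* Let $\mu,\nu\in\mathbb{C}$ with $\operatorname{Re}(\mu+\nu)>-1$. Then for $-1<x<1$, $$\frac{P_\nu^{-\mu}(x)}{\Gamma(\nu-\mu+1)}=\frac{2^{-\mu}(1-x)^{\mu}}{\Gamma(\nu+\mu+1)}\sum_{n=0}^{\infty}\frac{(-2\mu)_n(-\nu)_n}{n!}\left(\frac{1+x}{1-x}\right)^{\frac n2}P_{\nu-\mu}^{\mu-n}(x).$$
   Context: For $x\in(-1,1)$ and $\nu,\mu\in\mathbb{C}$ the Ferrers function of the first kind is $P_\nu^{-\mu}(x)=\left(\frac{1-x}{1+x}\right)^{\mu/2}\frac{F(-\nu,\nu+1;1+\mu;\frac{1-x}{2})}{\Gamma(1+\mu)}$, where $F$ is the Gauss hypergeometric function and $F(a,b;c;z)/\Gamma(c)$ is read as $\sum_k \frac{(a)_k(b)_k}{\Gamma(c+k)k!}z^k$, entire in $c$; it is entire in each of $\nu,\mu$. $P_\nu^{\sigma}$ denotes this function with $\mu=-\sigma$. $(a)_n=\Gamma(a+n)/\Gamma(a)$ is the Pochhammer symbol and $1/\Gamma$ is the entire reciprocal gamma function. *)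

theory Defs
  imports "HOL-Analysis.Analysis"
begin

text \<open>
  The regularized Gauss hypergeometric function \<open>F(a,b;c;z) / \<Gamma>(c)\<close>, entire in \<open>c\<close>.
  The series converges for \<open>norm z < 1\<close>, the only range in which it is used below.
\<close>

definition hypergeo_reg :: "complex \<Rightarrow> complex \<Rightarrow> complex \<Rightarrow> complex \<Rightarrow> complex" where
  "hypergeo_reg a b c z =
     (\<Sum>k. pochhammer a k * pochhammer b k * rGamma (c + of_nat k) / fact k * z ^ k)"

text \<open>
  \<open>ferrers_P \<nu> \<sigma> x\<close> is the Ferrers function of the first kind of degree \<open>\<nu>\<close> and order \<open>\<sigma>\<close>,
  with the order as the superscript in \<open>P\<^sub>\<nu>\<^sup>\<sigma>(x)\<close>; it is meaningful for \<open>-1 < x < 1\<close>, where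
  the base of the power is positive and the power takes its principal value.
\<close>

definition ferrers_P :: "complex \<Rightarrow> complex \<Rightarrow> real \<Rightarrow> complex" where
  "ferrers_P \<nu> \<sigma> x =
     of_real ((1 - x) / (1 + x)) powr (- \<sigma> / 2) *
     hypergeo_reg (- \<nu>) (\<nu> + 1) (1 - \<sigma>) (of_real ((1 - x) / 2))"

end

theory Submission
  imports Defs
begin

text \<open>
  In the variable \<open>z = (1 - x) / 2\<close> all fractional powers of \<open>(1 - x) / (1 + x)\<close> cancel. Euler's
  transformation turns the left-hand side into a multiple of \<open>F(1 + \<mu> + \<nu>, \<mu> - \<nu>; 1 + \<mu>; z)\<close>.
  Expanding the right-hand side in powers of \<open>z\<close> and exchanging the two summations, the coefficient
  of \<open>z^k\<close> is a hypergeometric series at \<open>1\<close> with parameters \<open>-2\<mu>, -\<nu>; 1 - \<mu> + k\<close>, which Gauss'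
  theorem evaluates; the assumption \<open>Re (\<mu> + \<nu>) > -1\<close> is exactly its convergence condition.

  Gauss' theorem follows by iterating the contiguous relation between \<open>c\<close> and \<open>c + 1\<close>, a telescoping
  series, and letting \<open>c\<close> tend to infinity. Euler's transformation is the Cauchy product with the
  binomial series of \<open>(1 - z)^(a + b - c)\<close>, whose coefficients Saalschuetz' identity evaluates; that
  identity is stated without division by \<open>(c)\<^sub>j\<close>, so it covers the poles of \<open>\<Gamma>(c)\<close>.
\<close>

section \<open>Asymptotics of Pochhammer symbols and of the reciprocal gamma function\<close>

text \<open>
  Both \<open>pochhammer z n\<close> and \<open>1 / rGamma (z + n)\<close> grow like \<open>(n - 1)! n^z\<close>, up to a constant.
\<close>

definition pochhammer_scale :: "complex \<Rightarrow> nat \<Rightarrow> complex" where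
  "pochhammer_scale z n = fact (n - 1) * exp (z * of_real (ln (of_nat n)))"

lemma pochhammer_scale_nonzero [simp]: "pochhammer_scale z n \<noteq> 0"
  by (simp add: pochhammer_scale_def)

lemma norm_pochhammer_scale:
  "n > 0 \<Longrightarrow> norm (pochhammer_scale z n) = fact (n - 1) * real n powr Re z"
  by (simp add: pochhammer_scale_def norm_mult powr_def norm_fact)

lemma pochhammer_scale_mult_cong:
  assumes "a + b = c + d"
  shows "pochhammer_scale a n * pochhammer_scale b n = pochhammer_scale c n * pochhammer_scale d n"
proof -
  have "exp (a * of_real (ln (of_nat n))) * exp (b * of_real (ln (of_nat n))) =
        exp (c * of_real (ln (of_nat n))) * (exp (d * of_real (ln (of_nat n))) :: complex)"
    by (simp flip: exp_add distrib_right add: assms)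
  then show ?thesis
    by (simp add: pochhammer_scale_def algebra_simps)
qed

text \<open>Off the poles this inverts the limit of \<open>Gamma_series'\<close>. At a nonpositive
  integer \<open>Gamma z\<close> is 0 by convention and cannot be inverted; there the Pochhammer
  symbol eventually vanishes, and so does \<open>rGamma z\<close>.\<close>

lemma pochhammer_asymp: "(\<lambda>n. pochhammer z n / pochhammer_scale z n) \<longlonglongrightarrow> rGamma z"
proof (cases "z \<in> \<int>\<^sub>\<le>\<^sub>0")
  case True
  then obtain k where k: "z = - of_nat k"
    by (elim nonpos_Ints_cases')
  have "eventually (\<lambda>n. 0 = pochhammer z n / pochhammer_scale z n) sequentially"
    using eventually_gt_at_top[of k]
    by eventually_elim (simp add: k pochhammer_of_nat_eq_0_iff)
  moreover have "rGamma z = 0"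
    using True by (simp add: rGamma_eq_zero_iff)
  ultimately show ?thesis
    by (auto intro: Lim_transform_eventually[OF tendsto_const])
next
  case False
  then have "Gamma z \<noteq> 0"
    by (simp add: Gamma_eq_zero_iff)
  with tendsto_inverse[OF Gamma_series'_LIMSEQ[of z]] show ?thesis
    by (simp add: Gamma_series'_def pochhammer_scale_def rGamma_inverse_Gamma)
qed

lemma not_nonpos_Ints_if_Re_pos: "Re w > 0 \<Longrightarrow> w \<notin> \<int>\<^sub>\<le>\<^sub>0"
  by (auto elim!: nonpos_Ints_cases')

lemma rGamma_nonzero: "Re w > 0 \<Longrightarrow> rGamma w \<noteq> 0"
  by (simp add: rGamma_eq_zero_iff not_nonpos_Ints_if_Re_pos)

lemma obtain_Re_shift_pos:
  obtains N where "Re (c + of_nat N) > 0"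
proof -
  obtain N where "real N > - Re c"
    using reals_Archimedean2 by blast
  then have "Re (c + of_nat N) > 0" by simp
  then show ?thesis by (rule that)
qed

text \<open>Off the poles \<open>pochhammer_rGamma\<close> reduces the limit to
  \<open>rGamma z * Gamma z = 1\<close>. A pole is reached by descending from \<open>z + N\<close>
  in unit steps: passing from \<open>z + 1\<close> to \<open>z\<close> multiplies the sequence by
  \<open>z / n + 1\<close>, which tends to 1.\<close>

lemma rGamma_shift_asymp: "(\<lambda>n. rGamma (z + of_nat n) * pochhammer_scale z n) \<longlonglongrightarrow> 1"
proof -
  have regular: "(\<lambda>n. rGamma (z + of_nat n) * pochhammer_scale z n) \<longlonglongrightarrow> 1"
    if "z \<notin> \<int>\<^sub>\<le>\<^sub>0" for z :: complex
  proof -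
    have "rGamma (z + of_nat n) * pochhammer_scale z n = rGamma z * Gamma_series' z n" for n
    proof -
      have "pochhammer z n \<noteq> 0"
        using that by (auto dest: pochhammer_eq_0_imp_nonpos_Int)
      then show ?thesis
        using pochhammer_rGamma[of z n]
        by (simp add: Gamma_series'_def pochhammer_scale_def field_simps)
    qed
    moreover have "(\<lambda>n. rGamma z * Gamma_series' z n) \<longlonglongrightarrow> rGamma z * Gamma z"
      by (intro tendsto_intros Gamma_series'_LIMSEQ)
    moreover have "rGamma z * Gamma z = 1"
      using that by (simp add: rGamma_inverse_Gamma Gamma_eq_zero_iff)
    ultimately show ?thesis by simp
  qed
  have step: "(\<lambda>n. rGamma (z + of_nat n) * pochhammer_scale z n) \<longlonglongrightarrow> 1"
    if lim: "(\<lambda>n. rGamma (z + 1 + of_nat n) * pochhammer_scale (z + 1) n) \<longlonglongrightarrow> 1" for z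
  proof (rule Lim_transform_eventually)
    have "(\<lambda>n. z / of_nat n) \<longlonglongrightarrow> 0"
      using tendsto_mult[OF tendsto_const[of z] lim_inverse_n] by (simp add: divide_inverse)
    then have "(\<lambda>n. (z / of_nat n + 1) * (rGamma (z + 1 + of_nat n) * pochhammer_scale (z + 1) n)) \<longlonglongrightarrow> (0 + 1) * 1"
      by (intro tendsto_intros lim)
    then show "(\<lambda>n. (z / of_nat n + 1) * (rGamma (z + 1 + of_nat n) * pochhammer_scale (z + 1) n)) \<longlonglongrightarrow> 1"
      by simp
    show "eventually (\<lambda>n. (z / of_nat n + 1) * (rGamma (z + 1 + of_nat n) * pochhammer_scale (z + 1) n)
            = rGamma (z + of_nat n) * pochhammer_scale z n) sequentially"
      using eventually_gt_at_top[of 0]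
    proof eventually_elim
      case (elim n)
      then have "pochhammer_scale (z + 1) n = of_nat n * pochhammer_scale z n"
        by (simp add: pochhammer_scale_def distrib_right exp_add exp_of_real)
      moreover have "rGamma (z + of_nat n) = (z + of_nat n) * rGamma (z + 1 + of_nat n)"
        using rGamma_plus1[of "z + of_nat n"] by (simp add: add_ac)
      ultimately show ?case
        using elim by (simp add: field_simps)
    qed
  qed
  have "(\<lambda>n. rGamma (z + of_nat n) * pochhammer_scale z n) \<longlonglongrightarrow> 1"
    if "z + of_nat N \<notin> \<int>\<^sub>\<le>\<^sub>0" for N z
    using that
  proof (induction N arbitrary: z)
    case 0
    then show ?case using regular[of z] by simp
  next
    case (Suc N)
    show ?case
      by (rule step, rule Suc.IH) (use Suc.prems in \<open>simp add: add_ac\<close>)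
  qed
  moreover obtain N where "Re (z + of_nat N) > 0"
    by (rule obtain_Re_shift_pos)
  ultimately show ?thesis
    using not_nonpos_Ints_if_Re_pos by blast
qed

section \<open>Growth of the hypergeometric coefficients and summability\<close>

text \<open>The power of \<open>z\<close> is left out so that \<open>suminf\<close> of the
  coefficients is the value at 1, the subject of Gauss' theorem.\<close>

definition hypergeo_coeff :: "complex \<Rightarrow> complex \<Rightarrow> complex \<Rightarrow> nat \<Rightarrow> complex" where
  "hypergeo_coeff a b c n = pochhammer a n * pochhammer b n * rGamma (c + of_nat n) / fact n"

lemma hypergeo_reg_altdef: "hypergeo_reg a b c z = (\<Sum>n. hypergeo_coeff a b c n * z ^ n)"
  by (simp add: hypergeo_reg_def hypergeo_coeff_def)

text \<open>After division by their scales the three factors converge, hence are bounded. The scales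
  contribute n^(a + b - c), and the quotient (n - 1)! / n! of the remaining factorials accounts for
  the -1 in the exponent.\<close>

lemma hypergeo_coeff_bound:
  obtains K where "\<And>n. n > 0 \<Longrightarrow> norm (hypergeo_coeff a b c n) \<le> K * real n powr Re (a + b - c - 1)"
proof -
  define u where "u = (\<lambda>n. pochhammer a n / pochhammer_scale a n * (pochhammer b n / pochhammer_scale b n) *
    (rGamma (c + of_nat n) * pochhammer_scale c n))"
  have "u \<longlonglongrightarrow> rGamma a * rGamma b * 1"
    unfolding u_def by (intro tendsto_intros pochhammer_asymp rGamma_shift_asymp)
  then have "Bseq u"
    by (intro convergent_imp_Bseq) (auto simp: convergent_def)
  then obtain K where K: "\<And>n. norm (u n) \<le> K"
    by (auto elim!: BseqE)
  have "norm (hypergeo_coeff a b c n) \<le> K * real n powr Re (a + b - c - 1)" if n: "n > 0" for n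
  proof -
    have "hypergeo_coeff a b c n =
      u n * (pochhammer_scale a n * pochhammer_scale b n / (pochhammer_scale c n * fact n))"
      by (simp add: hypergeo_coeff_def u_def field_simps)
    also have "norm \<dots> = norm (u n) * ((fact (n - 1) * real n powr Re a) * (fact (n - 1) * real n powr Re b)
       / ((fact (n - 1) * real n powr Re c) * fact n))"
      by (simp only: norm_mult norm_divide norm_pochhammer_scale[OF n] norm_fact)
    also have "\<dots> = norm (u n) * real n powr Re (a + b - c - 1)"
      using n by (cases n) (simp_all add: powr_add powr_diff field_simps del: of_nat_Suc)
    finally show ?thesis
      using mult_right_mono[OF K[of n], of "real n powr Re (a + b - c - 1)"] by simp
  qed
  then show ?thesis using that by blast
qed

lemma summable_hypergeo_coeff:
  assumes "Re (c - a - b) > 0"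
  shows "summable (\<lambda>n. norm (hypergeo_coeff a b c n))"
proof -
  obtain K where K: "\<And>n. n > 0 \<Longrightarrow> norm (hypergeo_coeff a b c n) \<le> K * real n powr Re (a + b - c - 1)"
    using hypergeo_coeff_bound[of a b c] by blast
  have "summable (\<lambda>n. K * real n powr Re (a + b - c - 1))"
    using assms by (intro summable_mult) (simp add: summable_real_powr_iff)
  then show ?thesis
    by (rule summable_comparison_test'[where N = 1]) (use K in auto)
qed

text \<open>This is the boundary term at infinity in the telescoping proof of the contiguous
  relation.\<close>

lemma mult_hypergeo_coeff_tendsto_0:
  assumes "Re (c - a - b) > 0"
  shows "(\<lambda>n. of_nat n * hypergeo_coeff a b c n) \<longlonglongrightarrow> 0"
proof -
  obtain K where K: "\<And>n. n > 0 \<Longrightarrow> norm (hypergeo_coeff a b c n) \<le> K * real n powr Re (a + b - c - 1)"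
    using hypergeo_coeff_bound[of a b c] by blast
  have "(\<lambda>n. K * real n powr (- Re (c - a - b))) \<longlonglongrightarrow> 0"
    using assms by (intro tendsto_mult_right_zero tendsto_neg_powr filterlim_real_sequentially) auto
  moreover have "eventually (\<lambda>n. norm (of_nat n * hypergeo_coeff a b c n) \<le> K * real n powr (- Re (c - a - b))) sequentially"
    using eventually_gt_at_top[of 0]
  proof eventually_elim
    case (elim n)
    have "norm (of_nat n * hypergeo_coeff a b c n) \<le> real n * (K * real n powr Re (a + b - c - 1))"
      using K[OF elim] by (simp add: norm_mult mult_left_mono)
    also have "\<dots> = K * real n powr (- Re (c - a - b))"
      using elim by (simp add: powr_add powr_diff field_simps powr_minus)
    finally show ?case .
  qed
  ultimately show ?thesis
    by (rule Lim_null_comparison[rotated])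
qed

lemma summable_hypergeo_reg:
  assumes "norm z < 1"
  shows "summable (\<lambda>n. norm (hypergeo_coeff a b c n * z ^ n))"
proof -
  obtain K where K: "\<And>n. n > 0 \<Longrightarrow> norm (hypergeo_coeff a b c n) \<le> K * real n powr Re (a + b - c - 1)"
    using hypergeo_coeff_bound[of a b c] by blast
  \<comment> \<open>Rounding the exponent up to a natural number gives a polynomial majorant, whose
    radius of convergence is 1 by the ratio test.\<close>
  obtain p where p: "real p \<ge> Re (a + b - c - 1)"
    using real_arch_simple by blast
  have *: "norm (hypergeo_coeff a b c n) \<le> \<bar>K\<bar> * real n ^ p" if n: "n > 0" for n
  proof -
    have "K * real n powr Re (a + b - c - 1) \<le> \<bar>K\<bar> * real n powr real p"
      using n p by (intro mult_mono powr_mono) auto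
    then show ?thesis
      using K[OF n] n by (simp add: powr_realpow)
  qed
  define f :: "nat \<Rightarrow> real" where "f = (\<lambda>n. real n ^ p)"
  have "(\<lambda>n. (real n / real (Suc n)) ^ p) \<longlonglongrightarrow> 1 ^ p"
    by (intro tendsto_power LIMSEQ_n_over_Suc_n)
  then have "conv_radius f = 1"
    by (intro conv_radius_ratio_limit_nonzero[where c = 1])
       (simp_all add: f_def power_divide norm_power one_ereal_def del: of_nat_Suc)
  then have "summable (\<lambda>n. norm (f n * norm z ^ n))"
    using assms by (intro abs_summable_in_conv_radius) simp
  then have "summable (\<lambda>n. \<bar>K\<bar> * norm (f n * norm z ^ n))"
    by (rule summable_mult)
  then show ?thesis
  proof (rule summable_comparison_test'[where N = 1])
    fix n :: nat assume "1 \<le> n"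
    then show "norm (norm (hypergeo_coeff a b c n * z ^ n)) \<le> \<bar>K\<bar> * norm (f n * norm z ^ n)"
      using mult_right_mono[OF *[of n], of "norm z ^ n"]
      by (simp add: f_def norm_mult norm_power abs_mult mult.assoc)
  qed
qed

section \<open>Gauss' theorem at argument 1\<close>

lemma hypergeo_coeff_rGamma_step:
  "hypergeo_coeff a b c n = (c + of_nat n) * hypergeo_coeff a b (c + 1) n"
  using rGamma_plus1[of "c + of_nat n"] by (simp add: hypergeo_coeff_def add_ac)

lemma hypergeo_coeff_Suc:
  "of_nat (Suc n) * hypergeo_coeff a b c (Suc n) = (a + of_nat n) * (b + of_nat n) * hypergeo_coeff a b (c + 1) n"
  by (simp add: hypergeo_coeff_def pochhammer_Suc add_ac del: of_nat_Suc) (simp add: field_simps)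

lemma hypergeo_coeff_contiguous:
  assumes "Re (c - a - b) > 0"
  shows "(c - a - b) * suminf (hypergeo_coeff a b c) = (c - a) * (c - b) * suminf (hypergeo_coeff a b (c + 1))"
proof -
  let ?h = "hypergeo_coeff a b"
  have s0: "summable (?h c)" and s1: "summable (?h (c + 1))"
    using assms by (auto intro!: summable_norm_cancel[OF summable_hypergeo_coeff])
  have "(\<lambda>n. of_nat n * ?h c n - of_nat (Suc n) * ?h c (Suc n)) sums (of_nat 0 * ?h c 0 - 0)"
    by (intro telescope_sums' mult_hypergeo_coeff_tendsto_0 assms)
  \<comment> \<open>Both sides are multiples of the coefficient for \<open>c + 1\<close>; what
    remains is the polynomial identity n(c + n) - (a + n)(b + n) = (c - a - b)(c + n) - (c - a)(c -
    b).\<close>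
  moreover have "of_nat n * ?h c n - of_nat (Suc n) * ?h c (Suc n)
     = (c - a - b) * ?h c n - (c - a) * (c - b) * ?h (c + 1) n" for n
    by (simp only: hypergeo_coeff_Suc hypergeo_coeff_rGamma_step[of a b c n]) (simp add: algebra_simps)
  moreover have "(\<lambda>n. (c - a - b) * ?h c n - (c - a) * (c - b) * ?h (c + 1) n) sums
     ((c - a - b) * suminf (?h c) - (c - a) * (c - b) * suminf (?h (c + 1)))"
    by (intro sums_diff sums_mult summable_sums s0 s1)
  ultimately show ?thesis
    using sums_unique2 by fastforce
qed

lemma hypergeo_coeff_contiguous_iterated:
  assumes "Re (c - a - b) > 0"
  shows "pochhammer (c - a - b) m * suminf (hypergeo_coeff a b c) =
    pochhammer (c - a) m * pochhammer (c - b) m * suminf (hypergeo_coeff a b (c + of_nat m))"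
proof (induction m)
  case 0
  then show ?case by simp
next
  case (Suc m)
  have "Re (c + of_nat m - a - b) > 0"
    using assms by (simp add: algebra_simps)
  note step = hypergeo_coeff_contiguous[OF this]
  have "pochhammer (c - a - b) (Suc m) * suminf (hypergeo_coeff a b c) =
      (c + of_nat m - a - b) * (pochhammer (c - a - b) m * suminf (hypergeo_coeff a b c))"
    by (simp add: pochhammer_Suc algebra_simps)
  also have "\<dots> = pochhammer (c - a) m * pochhammer (c - b) m *
      ((c + of_nat m - a - b) * suminf (hypergeo_coeff a b (c + of_nat m)))"
    by (subst Suc.IH) (simp add: mult_ac)
  also have "\<dots> = pochhammer (c - a) m * pochhammer (c - b) m *
      ((c + of_nat m - a) * (c + of_nat m - b) * suminf (hypergeo_coeff a b (c + of_nat (Suc m))))"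
    using step by (simp add: add_ac)
  also have "\<dots> = pochhammer (c - a) (Suc m) * pochhammer (c - b) (Suc m) * suminf (hypergeo_coeff a b (c + of_nat (Suc m)))"
    by (simp add: pochhammer_Suc diff_add_eq mult_ac del: of_nat_Suc)
  finally show ?case .
qed

text \<open>Each factor w + i of \<open>pochhammer w n\<close> has positive real part, so adding j
  does not decrease its modulus. The resulting bound separates the shifts j and n, which supplies
  majorants for Tannery's theorem and for the exchange of summations.\<close>

lemma norm_rGamma_shift:
  assumes "Re w > 0"
  shows "norm (rGamma (w + of_nat j + of_nat n)) * norm (rGamma w)
    \<le> norm (rGamma (w + of_nat j)) * norm (rGamma (w + of_nat n))"
proof -
  have "norm (pochhammer w n) \<le> norm (pochhammer (w + of_nat j) n)"
    unfolding pochhammer_prod prod_norm[symmetric]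
    using assms by (intro prod_mono) (auto simp: cmod_def intro!: power_mono)
  then have "norm (rGamma (w + of_nat j + of_nat n)) * (norm (pochhammer w n) * norm (rGamma (w + of_nat n)))
    \<le> norm (rGamma (w + of_nat j + of_nat n)) * (norm (pochhammer (w + of_nat j) n) * norm (rGamma (w + of_nat n)))"
    by (intro mult_left_mono mult_right_mono) auto
  moreover have "norm (rGamma w) = norm (pochhammer w n) * norm (rGamma (w + of_nat n))"
    by (simp flip: norm_mult pochhammer_rGamma)
  moreover have "norm (rGamma (w + of_nat j)) =
      norm (pochhammer (w + of_nat j) n) * norm (rGamma (w + of_nat j + of_nat n))"
    by (simp flip: norm_mult pochhammer_rGamma)
  ultimately show ?thesis
    by (simp add: mult_ac)
qed

text \<open>Relative to the scale of \<open>c\<close>, the extra shift by n costs a factor m^(-n).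
  The limit \<open>0 ^ n\<close> is 1 for n = 0 and 0 otherwise, so only the leading term of the
  series survives.\<close>

lemma rGamma_double_shift_asymp:
  "(\<lambda>m. rGamma (c + of_nat m + of_nat n) * pochhammer_scale c m) \<longlonglongrightarrow> 0 ^ n"
proof (rule Lim_transform_eventually)
  show "(\<lambda>m. (1 / of_nat m) ^ n * (rGamma (c + of_nat n + of_nat m) * pochhammer_scale (c + of_nat n) m)) \<longlonglongrightarrow> 0 ^ n"
    using tendsto_mult[OF tendsto_power[OF lim_1_over_n] rGamma_shift_asymp[of "c + of_nat n"]] by simp
  show "eventually (\<lambda>m. (1 / of_nat m) ^ n * (rGamma (c + of_nat n + of_nat m) * pochhammer_scale (c + of_nat n) m)
     = rGamma (c + of_nat m + of_nat n) * pochhammer_scale c m) sequentially"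
    using eventually_gt_at_top[of 0]
  proof eventually_elim
    case (elim m)
    then have "exp (of_nat n * of_real (ln (real m))) = (of_nat m ^ n :: complex)"
      by (simp add: exp_of_nat_mult exp_of_real)
    then have "pochhammer_scale (c + of_nat n) m = of_nat m ^ n * pochhammer_scale c m"
      by (simp add: pochhammer_scale_def distrib_right exp_add)
    then show ?case
      using elim by (simp add: power_divide add_ac)
  qed
qed

text \<open>Tannery's theorem allows the limit to be taken term by term; a fixed hypergeometric
  series at 1 with lower parameter \<open>w\<close> dominates.\<close>

lemma suminf_hypergeo_coeff_asymp:
  "(\<lambda>m. suminf (hypergeo_coeff a b (c + of_nat m)) * pochhammer_scale c m) \<longlonglongrightarrow> 1"
proof -
  define F where "F = (\<lambda>n m. hypergeo_coeff a b (c + of_nat m) n * pochhammer_scale c m)"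
  define L where "L = (\<lambda>n. pochhammer a n * pochhammer b n / fact n * 0 ^ n)"
  have lim: "F n \<longlonglongrightarrow> L n" for n
    using tendsto_mult[OF tendsto_const[of "pochhammer a n * pochhammer b n / fact n"] rGamma_double_shift_asymp[of c n]]
    by (simp add: F_def L_def hypergeo_coeff_def mult.assoc)
  have "Bseq (\<lambda>m. rGamma (c + of_nat m) * pochhammer_scale c m)"
    using rGamma_shift_asymp[of c] by (intro convergent_imp_Bseq) (auto simp: convergent_def)
  then obtain K where K: "\<And>m. norm (rGamma (c + of_nat m) * pochhammer_scale c m) \<le> K"
    by (auto elim!: BseqE)
  obtain M0 where M0: "Re (c + of_nat M0) > 0"
    by (rule obtain_Re_shift_pos)
  obtain M1 where M1: "Re (c - a - b + of_nat M1) > 0"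
    by (rule obtain_Re_shift_pos)
  \<comment> \<open>\<open>M\<close> is large enough for both uses of \<open>w\<close>: positive
    real part for \<open>norm_rGamma_shift\<close>, and convergence of the dominating
    series.\<close>
  define M where "M = max M0 M1"
  define w where "w = c + of_nat M"
  have w: "Re w > 0" "Re (w - a - b) > 0"
    using M0 M1 by (auto simp: w_def M_def max_def algebra_simps)
  define B where "B = K / norm (rGamma w)"
  have bound: "norm (F n m) \<le> B * norm (hypergeo_coeff a b w n)" if le: "m \<ge> M" for n m
  proof -
    obtain j where j: "m = M + j"
      using le_Suc_ex[OF le] by blast
    have "norm (rGamma (c + of_nat m + of_nat n)) * norm (pochhammer_scale c m) * norm (rGamma w)
       = (norm (rGamma (w + of_nat j + of_nat n)) * norm (rGamma w)) * norm (pochhammer_scale c m)"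
      by (simp add: w_def j add_ac mult_ac)
    also have "\<dots> \<le> (norm (rGamma (w + of_nat j)) * norm (rGamma (w + of_nat n))) * norm (pochhammer_scale c m)"
      by (intro mult_right_mono norm_rGamma_shift w) auto
    also have "\<dots> = norm (rGamma (c + of_nat m) * pochhammer_scale c m) * norm (rGamma (w + of_nat n))"
      by (simp add: w_def j norm_mult add_ac mult_ac)
    also have "\<dots> \<le> K * norm (rGamma (w + of_nat n))"
      by (intro mult_right_mono K) auto
    finally have "norm (rGamma (c + of_nat m + of_nat n)) * norm (pochhammer_scale c m)
       \<le> B * norm (rGamma (w + of_nat n))"
      using rGamma_nonzero[OF w(1)] by (simp add: B_def field_simps)
    from mult_left_mono[OF this, of "norm (pochhammer a n * pochhammer b n / fact n)"]
    show ?thesis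
      by (simp add: F_def hypergeo_coeff_def norm_mult norm_divide mult_ac)
  qed
  \<comment> \<open>The conjunct \<open>True\<close> is the vacuous condition on the first index,
    matching the shape of \<open>eventually_prodI\<close>.\<close>
  have "eventually (\<lambda>x. True \<and> snd x \<ge> M) (sequentially \<times>\<^sub>F sequentially)"
    by (intro eventually_prodI always_eventually eventually_ge_at_top) auto
  then have "eventually (\<lambda>(n, m). norm (F n m) \<le> B * norm (hypergeo_coeff a b w n))
      (sequentially \<times>\<^sub>F sequentially)"
    by eventually_elim (auto intro: bound)
  from tannerys_theorem[OF lim this]
  have "(\<lambda>m. suminf (\<lambda>n. F n m)) \<longlonglongrightarrow> suminf L"
    using summable_mult[OF summable_hypergeo_coeff[OF w(2)]] by simp
  moreover have "suminf L = 1"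
    unfolding L_def by (subst powser_zero) simp
  ultimately have "(\<lambda>m. suminf (\<lambda>n. F n m)) \<longlonglongrightarrow> 1"
    by simp
  then show ?thesis
  proof (rule Lim_transform_eventually)
    \<comment> \<open>For small m the series at 1 need not converge, so the factor is pulled out
      only from \<open>M\<close> on.\<close>
    have "suminf (\<lambda>n. F n m) = suminf (hypergeo_coeff a b (c + of_nat m)) * pochhammer_scale c m"
      if "m \<ge> M" for m
    proof -
      have "Re (c + of_nat m - a - b) > 0"
        using w(2) that by (simp add: w_def)
      then show ?thesis
        unfolding F_def
        by (intro suminf_mult2[symmetric] summable_norm_cancel[OF summable_hypergeo_coeff])
    qed
    then show "eventually (\<lambda>m. suminf (\<lambda>n. F n m) =
        suminf (hypergeo_coeff a b (c + of_nat m)) * pochhammer_scale c m) sequentially"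
      by (rule eventually_sequentiallyI)
  qed
qed

text \<open>The iterated contiguous relation, divided by the scales, gives one sequence two
  expressions with different limits. The scales cancel because (c - a) + (c - b) = (c - a - b) +
  c.\<close>

theorem hypergeo_gauss:
  assumes "Re (c - a - b) > 0"
  shows "rGamma (c - a - b) * suminf (hypergeo_coeff a b c) = rGamma (c - a) * rGamma (c - b)"
proof (rule LIMSEQ_unique)
  let ?q = "\<lambda>z n. pochhammer z n / pochhammer_scale z n"
  show "(\<lambda>n. ?q (c - a - b) n * suminf (hypergeo_coeff a b c)) \<longlonglongrightarrow> rGamma (c - a - b) * suminf (hypergeo_coeff a b c)"
    by (intro tendsto_intros pochhammer_asymp)
  have "(\<lambda>n. ?q (c - a) n * ?q (c - b) n * (suminf (hypergeo_coeff a b (c + of_nat n)) * pochhammer_scale c n))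
      \<longlonglongrightarrow> rGamma (c - a) * rGamma (c - b) * 1"
    by (intro tendsto_intros pochhammer_asymp suminf_hypergeo_coeff_asymp)
  moreover have "?q (c - a) n * ?q (c - b) n * (suminf (hypergeo_coeff a b (c + of_nat n)) * pochhammer_scale c n)
     = ?q (c - a - b) n * suminf (hypergeo_coeff a b c)" for n
  proof -
    have "pochhammer_scale (c - a) n * pochhammer_scale (c - b) n = pochhammer_scale (c - a - b) n * pochhammer_scale c n"
      by (rule pochhammer_scale_mult_cong) simp
    then show ?thesis
      using hypergeo_coeff_contiguous_iterated[OF assms, of n]
      by (simp add: divide_simps)
  qed
  ultimately show "(\<lambda>n. ?q (c - a - b) n * suminf (hypergeo_coeff a b c)) \<longlonglongrightarrow> rGamma (c - a) * rGamma (c - b)"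
    by simp
qed

section \<open>Saalschuetz' identity and Euler's transformation\<close>

text \<open>Passing from n to n + 1 multiplies either side by (c - a + n)(c - b + n) / (n + 1); for
  the sum this is a first-order recurrence obtained by telescoping.\<close>

lemma pochhammer_saalschuetz:
  fixes a b c :: complex
  defines "s \<equiv> c - a - b"
  shows "(\<Sum>j\<le>n. pochhammer s (n - j) / fact (n - j) * (pochhammer a j * pochhammer b j / fact j) * pochhammer (c + of_nat j) (n - j))
    = pochhammer (c - a) n * pochhammer (c - b) n / fact n"
proof (induction n)
  case 0
  show ?case by simp
next
  case (Suc n)
  define t where "t = (\<lambda>n j. pochhammer s (n - j) / fact (n - j) * (pochhammer a j * pochhammer b j / fact j) * pochhammer (c + of_nat j) (n - j))"
  \<comment> \<open>Wilf--Zeilberger: \<open>g\<close> certifies the recurrence in \<open>n\<close>. It is given in the shifted form \<open>g (Suc i)\<close>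
    because the form in \<open>g_alt\<close>, with truncated subtraction, is wrong at \<open>j = Suc n\<close>.\<close>
  define u where "u = (\<lambda>j. pochhammer s (n - j) / fact (Suc n - j) * (pochhammer a j * pochhammer b j / fact j) * pochhammer (c + of_nat j) (n - j))"
  define g where "g = (\<lambda>j. case j of 0 \<Rightarrow> 0 | Suc i \<Rightarrow> - of_nat (Suc n - i) * (a + of_nat i) * (b + of_nat i) * u i)"
  have g_alt: "g j = - of_nat j * (c + of_nat j - 1) * (s + of_nat (n - j)) * u j" if "j \<le> n" for j
  proof (cases j)
    case 0
    then show ?thesis by (simp add: g_def)
  next
    case (Suc i)
    with that obtain d where d: "n = Suc (i + d)"
      using le_Suc_ex[of j n] by auto
    have P: "pochhammer (c + of_nat i) (Suc d) = (c + of_nat i) * pochhammer (c + of_nat (Suc i)) d"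
      by (simp add: pochhammer_rec add_ac)
    have nz: "fact (Suc d) \<noteq> (0::complex)" "fact i \<noteq> (0::complex)" "of_nat (Suc (Suc d)) \<noteq> (0::complex)" "of_nat (Suc i) \<noteq> (0::complex)"
      by (simp_all del: of_nat_Suc fact_Suc)
    have 1: "g j = - of_nat (Suc (Suc d)) * (a + of_nat i) * (b + of_nat i) *
       (pochhammer s d * (s + of_nat d) / (of_nat (Suc (Suc d)) * fact (Suc d)) * (pochhammer a i * pochhammer b i / fact i) *
          ((c + of_nat i) * pochhammer (c + of_nat (Suc i)) d))"
      by (simp add: g_def Suc d u_def P Suc_diff_le pochhammer_Suc[of s] fact_Suc[of "Suc d"] del: of_nat_Suc fact_Suc)
    have 2: "u j = pochhammer s d / fact (Suc d) * (pochhammer a i * (a + of_nat i) * (pochhammer b i * (b + of_nat i)) / (of_nat (Suc i) * fact i)) *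
         pochhammer (c + of_nat (Suc i)) d"
      by (simp add: Suc d u_def pochhammer_Suc[of a] pochhammer_Suc[of b] fact_Suc[of i] Suc_diff_le del: of_nat_Suc fact_Suc)
    have 3: "c + of_nat j - 1 = c + of_nat i" "n - j = d"
      by (simp_all add: Suc d)
    show ?thesis
      unfolding 1 2 3 unfolding Suc using nz by (simp add: divide_simps del: of_nat_Suc fact_Suc)
  qed
  \<comment> \<open>With \<open>g_alt\<close> all four terms become multiples of the same
    \<open>u j\<close>, which leaves a polynomial identity.\<close>
  have diff: "of_nat (Suc n) * t (Suc n) j - (c - a + of_nat n) * (c - b + of_nat n) * t n j = g (Suc j) - g j"
    if le: "j \<le> n" for j
  proof -
    obtain d where d: "n = j + d"
      using le_Suc_ex[OF le] by blast
    have nz: "fact d \<noteq> (0::complex)" "of_nat (Suc d) \<noteq> (0::complex)"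
      by (simp_all del: of_nat_Suc)
    have "t n j = of_nat (Suc d) * u j"
      using nz by (simp add: t_def u_def d Suc_diff_le del: of_nat_Suc)
    moreover have "t (Suc n) j = (s + of_nat d) * (c + of_nat n) * u j"
      by (simp add: t_def u_def d Suc_diff_le pochhammer_Suc[of s] pochhammer_Suc[of "c + of_nat j"] add_ac del: of_nat_Suc fact_Suc)
    moreover have "g (Suc j) = - of_nat (Suc d) * (a + of_nat j) * (b + of_nat j) * u j"
      by (simp add: g_def d Suc_diff_le del: of_nat_Suc)
    moreover have "g j = - of_nat j * (c + of_nat j - 1) * (s + of_nat d) * u j"
      using g_alt[OF le] by (simp add: d)
    ultimately show ?thesis
      by (simp add: d s_def) (simp add: algebra_simps)
  qed
  have "of_nat (Suc n) * (\<Sum>j\<le>n. t (Suc n) j) - (c - a + of_nat n) * (c - b + of_nat n) * (\<Sum>j\<le>n. t n j)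
      = (\<Sum>j\<le>n. g (Suc j) - g j)"
    unfolding sum_distrib_left sum_subtractf[symmetric] by (intro sum.cong diff) auto
  also have "\<dots> = g (Suc n) - g 0"
    using sum_lessThan_telescope[of g "Suc n"] by (simp add: lessThan_Suc_atMost)
  \<comment> \<open>The boundary value of \<open>g\<close> is exactly the missing summand j = n + 1,
    up to sign and the factor n + 1; moving it across completes the sum.\<close>
  also have "\<dots> = - of_nat (Suc n) * t (Suc n) (Suc n)"
    by (simp add: g_def u_def t_def pochhammer_Suc del: of_nat_Suc)
  finally have "of_nat (Suc n) * (\<Sum>j\<le>Suc n. t (Suc n) j) =
      (c - a + of_nat n) * (c - b + of_nat n) * (\<Sum>j\<le>n. t n j)"
    by (simp add: algebra_simps)
  also have "(\<Sum>j\<le>n. t n j) = pochhammer (c - a) n * pochhammer (c - b) n / fact n"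
    using Suc.IH by (simp add: t_def)
  finally have "(\<Sum>j\<le>Suc n. t (Suc n) j) = pochhammer (c - a) (Suc n) * pochhammer (c - b) (Suc n) / fact (Suc n)"
    by (simp add: pochhammer_Suc divide_simps mult_ac del: of_nat_Suc)
  then show ?case
    by (simp add: t_def)
qed

lemma sums_one_minus_powr:
  assumes "norm (z :: complex) < 1"
  shows "(\<lambda>n. pochhammer s n / fact n * z ^ n) sums (1 - z) powr (- s)"
proof -
  have "(\<lambda>n. ((- s) gchoose n) * (- z) ^ n) sums (1 + - z) powr (- s)"
    using assms by (intro gen_binomial_complex) simp
  moreover have "((- s) gchoose n) * (- z) ^ n = pochhammer s n / fact n * z ^ n" for n
  proof -
    have "(- 1) ^ n * (- z) ^ n = z ^ n"
      by (simp flip: power_mult_distrib)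
    then show ?thesis
      by (simp add: gbinomial_pochhammer mult.commute mult.left_commute)
  qed
  ultimately show ?thesis by simp
qed

theorem hypergeo_reg_euler:
  assumes "norm z < 1"
  shows "hypergeo_reg a b c z * (1 - z) powr (- (c - a - b)) = hypergeo_reg (c - a) (c - b) c z"
proof -
  define s where "s = c - a - b"
  define f where "f = (\<lambda>n. hypergeo_coeff a b c n * z ^ n)"
  define g where "g = (\<lambda>n. pochhammer s n / fact n * z ^ n)"
  \<comment> \<open>Viewing the binomial series as a hypergeometric one with b = c = 1 gives its
    absolute convergence, as the Cauchy product requires.\<close>
  have "hypergeo_coeff s 1 1 n = pochhammer s n / fact n" for n
    using pochhammer_rGamma[of "1::complex" n] by (simp add: hypergeo_coeff_def pochhammer_fact mult.assoc)
  with summable_hypergeo_reg[OF assms, of s 1 1] have sg: "summable (\<lambda>n. norm (g n))"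
    by (simp add: g_def)
  have sf: "summable (\<lambda>n. norm (f n))"
    unfolding f_def by (rule summable_hypergeo_reg[OF assms])
  have "(\<Sum>j\<le>n. f j * g (n - j)) = hypergeo_coeff (c - a) (c - b) c n * z ^ n" for n
  proof -
    have "f j * g (n - j) = pochhammer s (n - j) / fact (n - j) * (pochhammer a j * pochhammer b j / fact j) *
        pochhammer (c + of_nat j) (n - j) * (rGamma (c + of_nat n) * z ^ n)" if "j \<le> n" for j
    proof -
      have "rGamma (c + of_nat j) = pochhammer (c + of_nat j) (n - j) * rGamma (c + of_nat n)"
        using pochhammer_rGamma[of "c + of_nat j" "n - j"] that by (simp add: add.assoc flip: of_nat_add)
      moreover have "z ^ n = z ^ j * z ^ (n - j)"
        using that by (simp flip: power_add)
      ultimately show ?thesis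
        by (simp add: f_def g_def hypergeo_coeff_def mult_ac)
    qed
    then have "(\<Sum>j\<le>n. f j * g (n - j)) = (\<Sum>j\<le>n. pochhammer s (n - j) / fact (n - j) * (pochhammer a j * pochhammer b j / fact j) *
        pochhammer (c + of_nat j) (n - j)) * (rGamma (c + of_nat n) * z ^ n)"
      by (simp add: sum_distrib_right)
    then show ?thesis
      unfolding s_def pochhammer_saalschuetz by (simp add: hypergeo_coeff_def)
  qed
  then have "hypergeo_reg (c - a) (c - b) c z = suminf f * suminf g"
    using Cauchy_product_sums[OF sf sg] by (simp add: hypergeo_reg_altdef sums_iff)
  moreover have "suminf g = (1 - z) powr (- s)"
    using sums_one_minus_powr[OF assms] by (simp add: g_def sums_iff)
  moreover have "suminf f = hypergeo_reg a b c z"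
    by (simp add: f_def hypergeo_reg_altdef)
  ultimately show ?thesis
    by (simp add: s_def)
qed

section \<open>Exchange of the two summations\<close>

text \<open>Fubini through unordered sums: \<open>row\<close> and \<open>total\<close> give absolute
  summability on the product, and \<open>col\<close> identifies the unordered inner sums over n with
  \<open>suminf\<close>.\<close>

lemma suminf_swap:
  fixes f :: "nat \<Rightarrow> nat \<Rightarrow> 'a :: banach"
  assumes row: "\<And>n. summable (\<lambda>k. norm (f n k))"
    and col: "\<And>k. summable (\<lambda>n. norm (f n k))"
    and total: "summable (\<lambda>n. \<Sum>k. norm (f n k))"
  shows "summable (\<lambda>n. \<Sum>k. f n k)" "(\<Sum>n. \<Sum>k. f n k) = (\<Sum>k. \<Sum>n. f n k)"
proof -
  have infsum_eq: "infsum g UNIV = suminf g" if "summable (\<lambda>n. norm (g n))" for g :: "nat \<Rightarrow> 'b :: banach"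
    by (rule infsumI, rule norm_summable_imp_has_sum[OF that], rule summable_sums, rule summable_norm_cancel[OF that])
  have norm_row: "(\<Sum>\<^sub>\<infinity>k. norm (f n k)) = (\<Sum>k. norm (f n k))" for n
    using row by (intro infsum_eq) simp
  have "(\<lambda>(n, k). f n k) abs_summable_on UNIV \<times> UNIV"
    unfolding Infinite_Sum.abs_summable_on_Sigma_iff
    using row total by (auto simp: norm_row suminf_nonneg intro!: norm_summable_imp_summable_on)
  then have double: "(\<lambda>(n, k). f n k) summable_on UNIV \<times> UNIV"
    by (rule abs_summable_summable)
  have rows: "(\<Sum>\<^sub>\<infinity>k. f n k) = (\<Sum>k. f n k)" for n
    by (rule infsum_eq[OF row])
  have cols: "(\<Sum>\<^sub>\<infinity>n. f n k) = (\<Sum>n. f n k)" for k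
    by (rule infsum_eq[OF col])
  have rows_summable: "(\<lambda>n. \<Sum>k. f n k) summable_on UNIV"
    using summable_on_Sigma_banach[OF double] by (simp add: rows)
  have "(\<lambda>(k, n). f n k) summable_on UNIV \<times> UNIV"
    using double by (subst (asm) summable_on_swap) (simp add: case_prod_unfold)
  then have cols_summable: "(\<lambda>k. \<Sum>n. f n k) summable_on UNIV"
    using summable_on_Sigma_banach[of "\<lambda>k n. f n k" UNIV "\<lambda>_. UNIV"] by (simp add: cols)
  show "summable (\<lambda>n. \<Sum>k. f n k)"
    by (rule summable_on_imp_summable[OF rows_summable])
  have suminf_infsum: "infsum g UNIV = suminf g" if "g summable_on UNIV" for g :: "nat \<Rightarrow> 'a"
    using has_sum_imp_sums[OF has_sum_infsum[OF that]] by (simp add: sums_iff)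
  show "(\<Sum>n. \<Sum>k. f n k) = (\<Sum>k. \<Sum>n. f n k)"
    using infsum_swap_banach[OF double] suminf_infsum[OF rows_summable] suminf_infsum[OF cols_summable]
    by (simp add: rows cols)
qed

text \<open>The gamma factor of the double family depends only on n + k. Hence each row is a series
  in \<open>z\<close> with lower parameter c + n, and each column a series at 1 with lower parameter
  c + k, to which Gauss' theorem applies.\<close>

lemma hypergeo_reg_shift_series:
  fixes a b c p q z :: complex
  assumes z: "norm z < 1" and conv: "Re (c - a - b) > 0"
  defines "d \<equiv> \<lambda>n. pochhammer a n * pochhammer b n / fact n"
  shows "summable (\<lambda>n. d n * hypergeo_reg p q (c + of_nat n) z)"
    and "(\<Sum>n. d n * hypergeo_reg p q (c + of_nat n) z) =
      (\<Sum>k. pochhammer p k * pochhammer q k / fact k * z ^ k * suminf (hypergeo_coeff a b (c + of_nat k)))"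
proof -
  define e where "e = (\<lambda>k. pochhammer p k * pochhammer q k / fact k * z ^ k)"
  define f where "f = (\<lambda>n k. d n * e k * rGamma (c + of_nat n + of_nat k))"
  have f_row: "f n k = d n * (hypergeo_coeff p q (c + of_nat n) k * z ^ k)" for n k
    by (simp add: f_def e_def hypergeo_coeff_def)
  have f_col: "f n k = e k * hypergeo_coeff a b (c + of_nat k) n" for n k
    by (simp add: f_def d_def hypergeo_coeff_def add_ac)
  have row: "summable (\<lambda>k. norm (f n k))" for n
    unfolding f_row norm_mult[of "d n"] by (intro summable_mult summable_hypergeo_reg z)
  have col: "summable (\<lambda>n. norm (f n k))" for k
  proof -
    have "Re (c + of_nat k - a - b) > 0"
      using conv by simp
    then show ?thesis
      unfolding f_col norm_mult[of "e k"] by (intro summable_mult summable_hypergeo_coeff)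
  qed
  obtain N where N: "Re (c + of_nat N) > 0"
    by (rule obtain_Re_shift_pos)
  define w where "w = c + of_nat N"
  have w: "Re w > 0" using N by (simp add: w_def)
  define E where "E = (\<Sum>k. norm (hypergeo_coeff p q w k * z ^ k)) / norm (rGamma w)"
  \<comment> \<open>From \<open>N\<close> on, the family is bounded by a product of a function of n
    and a function of k, both summable.\<close>
  have total: "summable (\<lambda>n. \<Sum>k. norm (f n k))"
  proof (rule summable_comparison_test')
    show "summable (\<lambda>n. E * norm (hypergeo_coeff a b c n))"
      by (intro summable_mult summable_hypergeo_coeff conv)
    fix n assume le: "n \<ge> N"
    obtain j where j: "n = N + j"
      using le_Suc_ex[OF le] by blast
    have bound: "norm (f n k) \<le> norm (hypergeo_coeff a b c n) / norm (rGamma w) * norm (hypergeo_coeff p q w k * z ^ k)" for k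
    proof -
      have "norm (rGamma (c + of_nat n + of_nat k)) * norm (rGamma w)
          \<le> norm (rGamma (c + of_nat n)) * norm (rGamma (w + of_nat k))"
        using norm_rGamma_shift[OF w, of j k] by (simp add: w_def j add_ac)
      then have "norm (rGamma (c + of_nat n + of_nat k))
          \<le> norm (rGamma (c + of_nat n)) * norm (rGamma (w + of_nat k)) / norm (rGamma w)"
        using rGamma_nonzero[OF w] by (simp add: field_simps)
      from mult_left_mono[OF this, of "norm (d n * e k)"] show ?thesis
        by (simp add: f_def d_def e_def hypergeo_coeff_def norm_mult norm_divide mult_ac)
    qed
    have "(\<Sum>k. norm (f n k)) \<le> (\<Sum>k. norm (hypergeo_coeff a b c n) / norm (rGamma w) * norm (hypergeo_coeff p q w k * z ^ k))"
      by (intro suminf_le bound row summable_mult summable_hypergeo_reg z)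
    also have "\<dots> = E * norm (hypergeo_coeff a b c n)"
      by (subst suminf_mult[OF summable_hypergeo_reg[OF z]]) (simp add: E_def)
    finally show "norm (\<Sum>k. norm (f n k)) \<le> E * norm (hypergeo_coeff a b c n)"
      using suminf_nonneg[OF row] by simp
  qed
  have rows: "(\<Sum>k. f n k) = d n * hypergeo_reg p q (c + of_nat n) z" for n
    unfolding f_row hypergeo_reg_altdef
    by (intro suminf_mult summable_norm_cancel[OF summable_hypergeo_reg[OF z]])
  have cols: "(\<Sum>n. f n k) = e k * suminf (hypergeo_coeff a b (c + of_nat k))" for k
    unfolding f_col using conv
    by (intro suminf_mult summable_norm_cancel[OF summable_hypergeo_coeff]) simp
  show "summable (\<lambda>n. d n * hypergeo_reg p q (c + of_nat n) z)"
    and "(\<Sum>n. d n * hypergeo_reg p q (c + of_nat n) z) =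
      (\<Sum>k. pochhammer p k * pochhammer q k / fact k * z ^ k * suminf (hypergeo_coeff a b (c + of_nat k)))"
    using suminf_swap[of f, OF row col total] by (simp_all add: rows cols) (simp_all add: e_def)
qed

section \<open>The series of Ferrers functions\<close>

lemma hypergeo_reg_order_series:
  assumes z: "norm z < 1" and conv: "Re (\<mu> + \<nu>) > -1"
  shows "rGamma (\<nu> + \<mu> + 1) * (\<Sum>n. pochhammer (- 2 * \<mu>) n * pochhammer (- \<nu>) n / fact n *
      hypergeo_reg (\<mu> - \<nu>) (\<nu> - \<mu> + 1) (1 - \<mu> + of_nat n) z)
    = rGamma (\<nu> - \<mu> + 1) * hypergeo_reg (1 + \<mu> + \<nu>) (\<mu> - \<nu>) (1 + \<mu>) z"
proof -
  define S where "S = (\<lambda>k. suminf (hypergeo_coeff (- 2 * \<mu>) (- \<nu>) (1 - \<mu> + of_nat k)))"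
  define e where "e = (\<lambda>k. pochhammer (\<mu> - \<nu>) k * pochhammer (\<nu> - \<mu> + 1) k / fact k * z ^ k)"
  have gauss: "rGamma (\<nu> + \<mu> + 1) * (e k * S k) =
    rGamma (\<nu> - \<mu> + 1) * (hypergeo_coeff (1 + \<mu> + \<nu>) (\<mu> - \<nu>) (1 + \<mu>) k * z ^ k)" for k
  proof -
    \<comment> \<open>For c = 1 - \<mu> + k, a = -2\<mu>, b = -\<nu> the three arguments in Gauss'
      theorem are c - a - b = \<nu> + \<mu> + 1 + k, c - a = 1 + \<mu> + k and c - b = \<nu> - \<mu>
      + 1 + k. The Pochhammer factors then absorb the shift by k in the first and the last.\<close>
    have "rGamma (\<nu> + \<mu> + 1 + of_nat k) * S k = rGamma (1 + \<mu> + of_nat k) * rGamma (\<nu> - \<mu> + 1 + of_nat k)"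
      using hypergeo_gauss[of "1 - \<mu> + of_nat k" "- 2 * \<mu>" "- \<nu>"] conv
      by (simp add: S_def algebra_simps)
    then have "pochhammer (\<nu> + \<mu> + 1) k * rGamma (\<nu> + \<mu> + 1 + of_nat k) * (e k * S k) =
       pochhammer (\<nu> + \<mu> + 1) k * e k * (rGamma (1 + \<mu> + of_nat k) * rGamma (\<nu> - \<mu> + 1 + of_nat k))"
      by simp
    also have "\<dots> = pochhammer (\<nu> - \<mu> + 1) k * rGamma (\<nu> - \<mu> + 1 + of_nat k) *
       (hypergeo_coeff (1 + \<mu> + \<nu>) (\<mu> - \<nu>) (1 + \<mu>) k * z ^ k)"
      by (simp add: e_def hypergeo_coeff_def add_ac)
    finally show ?thesis
      by (simp flip: pochhammer_rGamma)
  qed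
  have conv': "Re (1 - \<mu> - (- 2 * \<mu>) - (- \<nu>)) > 0"
    using conv by simp
  have summable: "summable (\<lambda>k. rGamma (\<nu> - \<mu> + 1) * (hypergeo_coeff (1 + \<mu> + \<nu>) (\<mu> - \<nu>) (1 + \<mu>) k * z ^ k))"
    by (intro summable_mult summable_norm_cancel[OF summable_hypergeo_reg[OF z]])
  have "Re (\<nu> + \<mu> + 1) > 0"
    using conv by simp
  then have nz: "rGamma (\<nu> + \<mu> + 1) \<noteq> 0"
    by (rule rGamma_nonzero)
  have "summable (\<lambda>k. rGamma (\<nu> + \<mu> + 1) * (e k * S k))"
    using summable by (simp only: gauss)
  then have "summable (\<lambda>k. e k * S k)"
    using nz by (simp add: summable_mult_D)
  then have "rGamma (\<nu> + \<mu> + 1) * (\<Sum>k. e k * S k) = (\<Sum>k. rGamma (\<nu> + \<mu> + 1) * (e k * S k))"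
    by (rule suminf_mult[symmetric])
  also have "\<dots> = rGamma (\<nu> - \<mu> + 1) * hypergeo_reg (1 + \<mu> + \<nu>) (\<mu> - \<nu>) (1 + \<mu>) z"
    unfolding gauss hypergeo_reg_altdef
    by (intro suminf_mult summable_norm_cancel[OF summable_hypergeo_reg[OF z]])
  finally show ?thesis
    unfolding hypergeo_reg_shift_series(2)[OF z conv'] by (simp add: e_def S_def)
qed

theorem theorem11:
  fixes \<mu> \<nu> :: complex and x :: real
  assumes "Re (\<mu> + \<nu>) > -1"
    and "-1 < x" and "x < 1"
  shows "summable (\<lambda>n. pochhammer (- 2 * \<mu>) n * pochhammer (- \<nu>) n / fact n *
           of_real (((1 + x) / (1 - x)) powr (real n / 2)) *
           ferrers_P (\<nu> - \<mu>) (\<mu> - of_nat n) x)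
       \<and> ferrers_P \<nu> (- \<mu>) x * rGamma (\<nu> - \<mu> + 1) =
         2 powr (- \<mu>) * of_real (1 - x) powr \<mu> * rGamma (\<nu> + \<mu> + 1) *
         (\<Sum>n. pochhammer (- 2 * \<mu>) n * pochhammer (- \<nu>) n / fact n *
           of_real (((1 + x) / (1 - x)) powr (real n / 2)) *
           ferrers_P (\<nu> - \<mu>) (\<mu> - of_nat n) x)"
proof -
  define z :: complex where "z = of_real ((1 - x) / 2)"
  define R where "R = (1 - x) / (1 + x)"
  define d where "d = (\<lambda>n. pochhammer (- 2 * \<mu>) n * pochhammer (- \<nu>) n / fact n)"
  define h where "h = (\<lambda>n. hypergeo_reg (\<mu> - \<nu>) (\<nu> - \<mu> + 1) (1 - \<mu> + of_nat n) z)"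
  have R: "R > 0" and R_inv: "(1 + x) / (1 - x) = inverse R"
    using assms by (simp_all add: R_def)
  have z: "norm z < 1"
    using assms by (simp add: z_def norm_of_real del: of_real_divide of_real_diff)
  \<comment> \<open>Lowering the order by n produces R^(n/2), which the explicit power in the series
    cancels; the factor R^(-\<mu>/2) left over does not depend on n.\<close>
  have term_eq: "d n * of_real (((1 + x) / (1 - x)) powr (real n / 2)) * ferrers_P (\<nu> - \<mu>) (\<mu> - of_nat n) x
     = of_real R powr (- \<mu> / 2) * (d n * h n)" for n
  proof -
    have "of_real R powr (- (\<mu> - of_nat n) / 2) = of_real R powr (- \<mu> / 2) * (of_real R powr (of_nat n / 2) :: complex)"
      by (simp add: diff_divide_distrib flip: powr_add)
    moreover have "of_real (inverse R powr (real n / 2)) * (of_real R powr (of_nat n / 2) :: complex) = 1"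
    proof -
      have "of_real R powr (of_nat n / 2) = (of_real (R powr (real n / 2)) :: complex)"
        using R powr_of_real[of R "real n / 2"] by simp
      then show ?thesis
        using R by (simp add: inverse_powr flip: of_real_mult)
    qed
    moreover have "ferrers_P (\<nu> - \<mu>) (\<mu> - of_nat n) x = of_real R powr (- (\<mu> - of_nat n) / 2) * h n"
      by (simp add: ferrers_P_def R_def h_def z_def algebra_simps)
    ultimately show ?thesis
      unfolding R_inv by (simp add: mult_ac)
  qed
  have conv: "Re (1 - \<mu> - (- 2 * \<mu>) - (- \<nu>)) > 0"
    using assms(1) by simp
  have summable: "summable (\<lambda>n. d n * h n)"
    unfolding d_def h_def by (rule hypergeo_reg_shift_series(1)[OF z conv])
  have euler: "hypergeo_reg (- \<nu>) (\<nu> + 1) (1 + \<mu>) z = (1 - z) powr \<mu> * hypergeo_reg (1 + \<mu> + \<nu>) (\<mu> - \<nu>) (1 + \<mu>) z"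
  proof -
    have "1 - z \<noteq> 0"
      using z by auto
    then have inv: "(1 - z) powr \<mu> * (1 - z) powr (- \<mu>) = 1"
      by (simp flip: powr_add)
    have "hypergeo_reg (- \<nu>) (\<nu> + 1) (1 + \<mu>) z * (1 - z) powr (- \<mu>) = hypergeo_reg (1 + \<mu> + \<nu>) (\<mu> - \<nu>) (1 + \<mu>) z"
      using hypergeo_reg_euler[OF z, of "- \<nu>" "\<nu> + 1" "1 + \<mu>"] by (simp add: algebra_simps)
    then have "(1 - z) powr \<mu> * hypergeo_reg (1 + \<mu> + \<nu>) (\<mu> - \<nu>) (1 + \<mu>) z
        = hypergeo_reg (- \<nu>) (\<nu> + 1) (1 + \<mu>) z * ((1 - z) powr \<mu> * (1 - z) powr (- \<mu>))"
      by (simp add: mult_ac)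
    with inv show ?thesis by simp
  qed
  \<comment> \<open>Since 1 - z = (1 + x) / 2, this says R^\<mu> ((1 + x) / 2)^\<mu> = 2^(-\<mu>) (1
    - x)^\<mu>. All bases are positive reals, so it becomes a linear identity between real
    logarithms.\<close>
  have powers: "of_real R powr (\<mu> / 2) * (1 - z) powr \<mu> = 2 powr (- \<mu>) * of_real (1 - x) powr \<mu> * of_real R powr (- \<mu> / 2)"
  proof -
    have powr_exp: "of_real r powr c = exp (c * of_real (ln r))" if "r > 0" for r :: real and c :: complex
      using that by (simp add: powr_def Ln_of_real)
    have two: "2 powr (- \<mu>) = exp (- \<mu> * of_real (ln 2))"
      using powr_exp[of 2 "- \<mu>"] by simp
    have one_minus: "of_real (1 - x) powr \<mu> = exp (\<mu> * of_real (ln (1 - x)))"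
      using assms by (intro powr_exp) simp
    have R_powr: "of_real R powr c = exp (c * of_real (ln (1 - x) - ln (1 + x)))" for c :: complex
      using powr_exp[OF R] assms by (simp add: R_def ln_div)
    have "1 - z = of_real ((1 + x) / 2)"
      by (simp add: z_def field_simps)
    then have "of_real R powr (\<mu> / 2) * (1 - z) powr \<mu> =
        exp (\<mu> / 2 * of_real (ln (1 - x) - ln (1 + x)) + \<mu> * of_real (ln (1 + x) - ln 2))"
      using assms by (simp add: R_powr powr_exp ln_div exp_add del: of_real_divide of_real_add of_real_diff)
    also have "\<dots> = exp (- \<mu> * of_real (ln 2) + \<mu> * of_real (ln (1 - x)) + - \<mu> / 2 * of_real (ln (1 - x) - ln (1 + x)))"
      by (intro arg_cong[of _ _ exp]) (simp add: field_simps)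
    also have "\<dots> = 2 powr (- \<mu>) * of_real (1 - x) powr \<mu> * of_real R powr (- \<mu> / 2)"
      by (simp only: two one_minus R_powr exp_add)
    finally show ?thesis .
  qed
  have "ferrers_P \<nu> (- \<mu>) x = of_real R powr (\<mu> / 2) * hypergeo_reg (- \<nu>) (\<nu> + 1) (1 + \<mu>) z"
    by (simp add: ferrers_P_def R_def z_def)
  then have "ferrers_P \<nu> (- \<mu>) x * rGamma (\<nu> - \<mu> + 1)
     = of_real R powr (\<mu> / 2) * (1 - z) powr \<mu> * (rGamma (\<nu> - \<mu> + 1) * hypergeo_reg (1 + \<mu> + \<nu>) (\<mu> - \<nu>) (1 + \<mu>) z)"
    by (simp add: euler)
  also have "\<dots> = 2 powr (- \<mu>) * of_real (1 - x) powr \<mu> * of_real R powr (- \<mu> / 2) * (rGamma (\<nu> + \<mu> + 1) * (\<Sum>n. d n * h n))"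
    unfolding powers d_def h_def hypergeo_reg_order_series[OF z assms(1)] ..
  also have "\<dots> = 2 powr (- \<mu>) * of_real (1 - x) powr \<mu> * rGamma (\<nu> + \<mu> + 1) * (\<Sum>n. of_real R powr (- \<mu> / 2) * (d n * h n))"
    by (simp add: suminf_mult[OF summable])
  finally show ?thesis
    using summable_mult[OF summable, of "of_real R powr (- \<mu> / 2)"]
    unfolding term_eq[unfolded d_def, symmetric] d_def term_eq by simp
qed


end
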